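(* Let $\lambda,\omega\in(0,1)$ be such that $(1-\lambda)/\lambda$ is an integer multiple of $\omega$, let $R<C(\lambda,\omega)=1-\lambda-\omega+\lambda\omega^2$, and let $\pi>0$. Then (for all sufficiently large $N$) there exists an error correcting code of rate at least $R$ for the channel $\mathrm{SNC}(\lambda,\omega)$ together with a decoding algorithm that achieves symbol error probability smaller than $\pi$, with decoding complexity $O(N^4\log\log(1/\pi))$ operations.
   Context: Fix a prime power $q$. For an integer $N$ let $\ell=\lambda N$ and $m=N-\ell$. The symmetric network coding channel $\mathrm{SNC}(\lambda,\omega)$ takes as input an $\ell\times m$ matrix $\underline{x}$ over $\mathbb{F}_q$ and outputs $\underline{y}=\underline{x}+\underline{z}$, where $\underline{z}$ is uniformly random, independent of $\underline{x}$, among all $\ell\times m$ matrices over $\mathbb{F}_q$ of rank $\ell\omega$. A code $\mathfrak{C}$ is a set of $\ell\times m$ matrices over $\mathbb{F}_q$ (each row is a packet of length $N$ once an $\ell\times\ell$ identity header is prepended); its rate is $R(\mathfrak{C})=\log_q|\mathfrak{C}|/(N\ell)$. The symbol error probability is the probability that a row of the transmitted matrix is decoded incorrectly (per row of $\underline{x}$). Complexity is measured in operations over $\mathbb{F}_q$. *)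

theory Defs
  imports Complex_Main "Jordan_Normal_Form.DL_Rank"
begin

text \<open>The finite field F_q is modelled by a type 'a of class finite and field;
  q = CARD('a). Matrices are Jordan_Normal_Form matrices; rank is the library rank.\<close>

definition mat_rank :: "'a::field mat \<Rightarrow> nat" where
  "mat_rank A = vec_space.rank (dim_row A) A"

text \<open>Noise set of SNC: all l x m matrices of rank r (here r = l*omega).\<close>
definition noise_set :: "nat \<Rightarrow> nat \<Rightarrow> nat \<Rightarrow> 'a::field mat set" where
  "noise_set l m r = {z \<in> carrier_mat l m. mat_rank z = r}"

text \<open>An instruction computes a new field element from previously computed ones
  (the inputs occupy the first positions of the memory). Every instruction is one
  operation over F_q.\<close>
datatype 'a instr =
    IConst 'a
  | IAdd nat nat
  | ISub nat nat
  | IMul nat nat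
  | IDiv nat nat

fun exec_instr :: "'a::field list \<Rightarrow> 'a instr \<Rightarrow> 'a" where
  "exec_instr mem (IConst c) = c"
| "exec_instr mem (IAdd i j) = mem ! i + mem ! j"
| "exec_instr mem (ISub i j) = mem ! i - mem ! j"
| "exec_instr mem (IMul i j) = mem ! i * mem ! j"
| "exec_instr mem (IDiv i j) = mem ! i / mem ! j"

definition run_slp :: "'a::field instr list \<Rightarrow> 'a list \<Rightarrow> 'a list" where
  "run_slp prog inp = foldl (\<lambda>mem ins. mem @ [exec_instr mem ins]) inp prog"

text \<open>A decoder: a program together with the list of memory positions holding the
  output entries. Well-formedness: every instruction only reads earlier cells.\<close>
definition wf_slp :: "nat \<Rightarrow> 'a instr list \<Rightarrow> nat list \<Rightarrow> bool" where
  "wf_slp n prog outs \<longleftrightarrow>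
     (\<forall>k < length prog. case prog ! k of
         IConst c \<Rightarrow> True
       | IAdd i j \<Rightarrow> i < n + k \<and> j < n + k
       | ISub i j \<Rightarrow> i < n + k \<and> j < n + k
       | IMul i j \<Rightarrow> i < n + k \<and> j < n + k
       | IDiv i j \<Rightarrow> i < n + k \<and> j < n + k)
     \<and> (\<forall>p \<in> set outs. p < n + length prog)"

definition mat_to_list :: "'a mat \<Rightarrow> 'a list" where
  "mat_to_list A = [A $$ (i, j). i \<leftarrow> [0..<dim_row A], j \<leftarrow> [0..<dim_col A]]"

definition slp_decode :: "nat \<Rightarrow> nat \<Rightarrow> 'a::field instr list \<Rightarrow> nat list \<Rightarrow> 'a mat \<Rightarrow> 'a mat" where
  "slp_decode l m prog outs y =
     (let mem = run_slp prog (mat_to_list y) in mat l m (\<lambda>(i, j). mem ! (outs ! (i * m + j))))"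

definition code_rate :: "nat \<Rightarrow> nat \<Rightarrow> 'a::finite mat set \<Rightarrow> real" where
  "code_rate N l C = log (real (card (UNIV :: 'a set))) (real (card C)) / (real N * real l)"

text \<open>Symbol error probability: codeword x uniform on the code C, noise z uniform on
  the noise set Z (independent), averaged over the l rows: probability that row i
  of the decoder output differs from row i of x.\<close>
definition symbol_error_prob ::
  "nat \<Rightarrow> 'a::field mat set \<Rightarrow> 'a mat set \<Rightarrow> ('a mat \<Rightarrow> 'a mat) \<Rightarrow> real" where
  "symbol_error_prob l C Z dec =
     (\<Sum>x\<in>C. \<Sum>z\<in>Z. \<Sum>i<l.
        (if row (dec (x + z)) i \<noteq> row x i then 1 else 0))
     / (real (card C) * real (card Z) * real l)"

end

(* Error trapping. The codewords vanish on their first a = r + s rows and columns, where s is a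
   constant, so the decoder sees these entries of the noise z unperturbed. If projection to the first
   a coordinates is injective on both the column space and the row space of z, then z has rank r
   already in its a x a corner and is reduced to zero by eliminating with pivots from that corner;
   the same elimination leaves the codeword untouched. As a^2 pivots each cost O(l m) operations, the
   decoder takes O(N^4) operations. Since the noise is invariant under invertible matrices on either
   side, a union bound over the vectors with a vanishing prefix shows that each injectivity condition
   fails with probability at most q^(-s). The dimension (l - a) (m - a) of the code is asymptotically
   the capacity. For R <= 0 the code {0} suffices. *)
theory Submission
  imports Defs "HOL-Library.Cardinality"
begin

section \<open>Rank factorisation\<close>

context vec_space
begin

text \<open>\<open>rank\<close> is the dimension of the column span regarded as a vector space of
  its own. A basis there keeps its span and its independence in the ambient space, where exchange
  arguments apply.\<close>

lemma rank_eq_card_spanning: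
  assumes A: "A \<in> carrier_mat n nc"
  obtains b where "finite b" "b \<subseteq> carrier_vec n" "span b = span (set (cols A))" "card b = rank A"
    "lin_indpt b"
proof -
  let ?S = "set (cols A)"
  have S: "?S \<subseteq> carrier_vec n" using A cols_dim by blast
  have sub: "submodule class_ring (span ?S) V" using S span_is_submodule by simp
  have vs: "vectorspace class_ring (span_vs ?S)"
    using S span_is_subspace subspace_is_vs by simp
  obtain b where b: "finite b" "vectorspace.basis class_ring (span_vs ?S) b"
    using vectorspace.finite_basis_exists[OF vs fin_dim_span_cols[OF A]] by blast
  then have bs: "b \<subseteq> span ?S" and gen: "LinearCombinations.module.span class_ring (span_vs ?S) b = span ?S"
    and li: "LinearCombinations.module.lin_indpt class_ring (span_vs ?S) b"
    unfolding vectorspace.basis_def[OF vs] by auto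
  have "span b = span ?S" using gen span_li_not_depend(1)[OF bs sub] by simp
  moreover have "lin_indpt b" using li span_li_not_depend(2)[OF bs sub] by simp
  moreover have "b \<subseteq> carrier_vec n" using bs span_closed[of ?S] S by (auto simp: subset_iff)
  moreover have "card b = rank A" unfolding rank_def using vectorspace.dim_basis[OF vs b] by simp
  ultimately show thesis using that b(1) by blast
qed

text \<open>The columns of \<open>U\<close> are a basis of the column span; column \<open>j\<close>
  of \<open>W\<close> lists the coordinates of column \<open>j\<close> of \<open>A\<close> in
  it.\<close>

lemma rank_factorisation:
  assumes A: "A \<in> carrier_mat n nc"
  obtains U W where "U \<in> carrier_mat n (rank A)" "W \<in> carrier_mat (rank A) nc" "A = U * W"
proof -
  obtain b where b: "finite b" "b \<subseteq> carrier_vec n" "span b = span (set (cols A))" "card b = rank A"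
    using rank_eq_card_spanning[OF A] .
  obtain bs where bs: "set bs = b" "length bs = rank A"
    using finite_distinct_list[OF b(1)] b(4) distinct_card by metis
  have "\<exists>c. col A j = mat_of_cols n bs *\<^sub>v vec (rank A) c" if "j < nc" for j
  proof -
    have S: "set (cols A) \<subseteq> carrier_vec n" using A cols_dim by blast
    have "col A j \<in> set (cols A)" using that A by (auto simp: cols_def)
    then have "col A j \<in> span b" using b(3) in_own_span[OF S] by blast
    then have "col A j \<in> span_list bs" using span_list_as_span[of bs] bs b(2) by simp
    then obtain c where "col A j = lincomb_list c bs" unfolding span_list_def by auto
    moreover have "\<forall>w\<in>set bs. dim_vec w = n" using bs b(2) by auto
    ultimately show ?thesis using lincomb_list_as_mat_mult[of bs c] bs(2) by auto
  qed
  then obtain c where c: "\<And>j. j < nc \<Longrightarrow> col A j = mat_of_cols n bs *\<^sub>v vec (rank A) (c j)" by metis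
  define W where "W = mat (rank A) nc (\<lambda>(i, j). c j i)"
  have U: "mat_of_cols n bs \<in> carrier_mat n (rank A)" using bs(2) by auto
  have W: "W \<in> carrier_mat (rank A) nc" unfolding W_def by simp
  have colV: "col W j = vec (rank A) (c j)" if "j < nc" for j
    using that unfolding W_def by (intro eq_vecI) auto
  have "A = mat_of_cols n bs * W"
  proof (rule eq_matI)
    fix i j assume ij: "i < dim_row (mat_of_cols n bs * W)" "j < dim_col (mat_of_cols n bs * W)"
    then have "j < nc" "i < n" using W by auto
    then have "A $$ (i, j) = col A j $ i" using A by auto
    also have "\<dots> = (mat_of_cols n bs *\<^sub>v col W j) $ i" using c colV \<open>j < nc\<close> by simp
    also have "\<dots> = (mat_of_cols n bs * W) $$ (i, j)" using \<open>i < n\<close> \<open>j < nc\<close> U W by auto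
    finally show "A $$ (i, j) = (mat_of_cols n bs * W) $$ (i, j)" .
  qed (use A W in auto)
  with U W that show thesis by blast
qed

text \<open>Every column of \<open>U * W\<close> is a combination of the \<open>k\<close> columns of
  \<open>U\<close>, so the exchange lemma bounds the size of a basis of their span.\<close>

lemma rank_mult_le:
  assumes U: "U \<in> carrier_mat n k" and W: "W \<in> carrier_mat k nc"
  shows "rank (U * W) \<le> k"
proof -
  have UV: "U * W \<in> carrier_mat n nc" using U W by simp
  obtain b where b: "finite b" "b \<subseteq> carrier_vec n" "span b = span (set (cols (U * W)))"
    "card b = rank (U * W)" "lin_indpt b"
    using rank_eq_card_spanning[OF UV] .
  have SU: "set (cols U) \<subseteq> carrier_vec n" using U cols_dim by blast
  have "set (cols (U * W)) \<subseteq> span (set (cols U))"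
  proof
    fix x assume "x \<in> set (cols (U * W))"
    then obtain j where j: "j < nc" "x = col (U * W) j" using UV by (auto simp: cols_def)
    then have "x = U *\<^sub>v col W j" using U W by (intro eq_vecI) auto
    also have "\<dots> = mat_of_cols n (cols U) *\<^sub>v vec (length (cols U)) (\<lambda>i. col W j $ i)"
    proof -
      have "vec (length (cols U)) (\<lambda>i. col W j $ i) = col W j" using U W j by (intro eq_vecI) auto
      then show ?thesis using mat_of_cols_cols[of U] U by simp
    qed
    also have "\<dots> = lincomb_list (\<lambda>i. col W j $ i) (cols U)"
      using lincomb_list_as_mat_mult[of "cols U" "\<lambda>i. col W j $ i"] SU by (auto simp: subset_iff)
    also have "\<dots> \<in> span_list (cols U)" unfolding span_list_def by auto
    finally show "x \<in> span (set (cols U))" using span_list_as_span[OF SU] by simp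
  qed
  then have "span b \<subseteq> span (set (cols U))" using b(3) span_subsetI[OF SU] by simp
  then have "b \<subseteq> span (set (cols U))" using in_own_span[of b] b(2) by simp
  then have "card b \<le> card (set (cols U))"
    using replacement[of b "set (cols U)"] b(1,5) SU by auto
  also have "\<dots> \<le> k" using card_length[of "cols U"] U by simp
  finally show ?thesis using b(4) by simp
qed

end

lemma mat_rank_factorisation:
  assumes "A \<in> carrier_mat n nc"
  obtains U V where "U \<in> carrier_mat n (mat_rank A)" "V \<in> carrier_mat (mat_rank A) nc" "A = U * V"
proof -
  have eq: "vec_space.rank n A = mat_rank A" using assms by (simp add: mat_rank_def)
  show thesis using vec_space.rank_factorisation[OF assms] that unfolding eq .
qed

lemma mat_rank_mult_le:
  assumes "U \<in> carrier_mat n k" "V \<in> carrier_mat k nc"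
  shows "mat_rank (U * V) \<le> k"
  using vec_space.rank_mult_le[OF assms] assms by (simp add: mat_rank_def)

lemma mat_rank_mult_left_le:
  assumes P: "P \<in> carrier_mat n' n" and A: "A \<in> carrier_mat n nc"
  shows "mat_rank (P * A) \<le> mat_rank A"
proof -
  obtain U V where UV: "U \<in> carrier_mat n (mat_rank A)" "V \<in> carrier_mat (mat_rank A) nc" "A = U * V"
    using mat_rank_factorisation[OF A] .
  then have "P * A = (P * U) * V" using assoc_mult_mat[OF P UV(1,2)] by simp
  with mat_rank_mult_le[OF mult_carrier_mat[OF P UV(1)] UV(2)] show ?thesis by simp
qed

text \<open>Transposing a rank factorisation swaps its factors and keeps the inner dimension. This
  gives one inequality, and applied to \<open>A\<^sup>T\<close> the other.\<close>

lemma mat_rank_transpose: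
  assumes A: "A \<in> carrier_mat n nc"
  shows "mat_rank A\<^sup>T = mat_rank A"
proof -
  have le: "mat_rank B\<^sup>T \<le> mat_rank B" if B: "B \<in> carrier_mat k kc" for B :: "'a mat" and k kc
  proof -
    obtain U V where UV: "U \<in> carrier_mat k (mat_rank B)" "V \<in> carrier_mat (mat_rank B) kc" "B = U * V"
      using mat_rank_factorisation[OF B] .
    then have "B\<^sup>T = V\<^sup>T * U\<^sup>T" using transpose_mult[OF UV(1,2)] by simp
    with mat_rank_mult_le[of "V\<^sup>T" kc "mat_rank B" "U\<^sup>T" k] UV show ?thesis by simp
  qed
  from le[OF A] le[of "A\<^sup>T" nc n] A show ?thesis by simp
qed

section \<open>Branch-free elimination\<close>

text \<open>One elimination step with pivot \<open>(i, j)\<close>. Because \<open>x / 0 = 0\<close>, it leaves the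
  matrix unchanged when the pivot vanishes, so no branching is needed.\<close>
definition deflate :: "nat \<times> nat \<Rightarrow> (nat \<Rightarrow> nat \<Rightarrow> 'a::field) \<Rightarrow> nat \<Rightarrow> nat \<Rightarrow> 'a" where
  "deflate = (\<lambda>(i, j) Y p q. Y p q - Y p j * (Y i q / Y i j))"

text \<open>Column by column: this order lets each sweep finish one column of the corner before the
  next begins.\<close>

definition pivots :: "nat \<Rightarrow> (nat \<times> nat) list" where
  "pivots a = concat (map (\<lambda>j. map (\<lambda>i. (i, j)) [0..<a]) [0..<a])"

lemma set_pivots: "set (pivots a) = {..<a} \<times> {..<a}"
  unfolding pivots_def by auto

lemma length_pivots: "length (pivots a) = a * a"
  unfolding pivots_def by (simp add: length_concat o_def sum_list_triv)

text \<open>Injectivity of the projection to the first \<open>a\<close> coordinates on the column space of the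
  \<open>l \<times> m\<close> matrix with entry function \<open>Y\<close>; the values of \<open>Y\<close> outside that range are irrelevant.\<close>
definition top_determines :: "nat \<Rightarrow> nat \<Rightarrow> nat \<Rightarrow> (nat \<Rightarrow> nat \<Rightarrow> 'a::field) \<Rightarrow> bool" where
  "top_determines a l m Y \<longleftrightarrow>
     (\<forall>v. (\<forall>p<a. (\<Sum>q<m. Y p q * v q) = 0) \<longrightarrow> (\<forall>p<l. (\<Sum>q<m. Y p q * v q) = 0))"

text \<open>Besides the entry being updated, a step reads only the row and the column of its pivot.
  \<open>X\<close> vanishes there, so the multipliers are those of \<open>Y\<close> and
  \<open>X\<close> is carried along unchanged. This is why elimination spares the codeword.\<close>

lemma fold_offset:
  assumes "set ps \<subseteq> {..<a} \<times> {..<a}" and "\<And>p q. p < a \<or> q < a \<Longrightarrow> X p q = 0"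
  shows "fold deflate ps (\<lambda>p q. X p q + Y p q) = (\<lambda>p q. X p q + fold deflate ps Y p q)"
  using assms(1)
proof (induction ps arbitrary: Y)
  case (Cons ij ps)
  obtain i j where ij: "ij = (i, j)" "i < a" "j < a" using Cons.prems by (cases ij) auto
  have "deflate ij (\<lambda>p q. X p q + Y p q) = (\<lambda>p q. X p q + deflate ij Y p q)"
    unfolding deflate_def using ij assms(2) by (auto intro!: ext)
  with Cons show ?case by simp
qed simp

section \<open>Column and row spaces under elimination\<close>

lemma deflate_transpose:
  "(\<lambda>q p. deflate (i, j) Y p q) = deflate (j, i) (\<lambda>q p. Y p q)"
  unfolding deflate_def by (auto intro!: ext)

text \<open>A step acts as multiplication from the right by a matrix that alters only coordinate
  \<open>j\<close> of \<open>v\<close>. The column space can therefore only shrink, which preserves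
  injectivity of a projection on it.\<close>

lemma sum_deflate:
  assumes "j < m"
  shows "(\<Sum>q<m. deflate (i, j) Y p q * v q)
    = (\<Sum>q<m. Y p q * (v q - (if q = j then (\<Sum>q<m. Y i q * v q) / Y i j else 0)))"
proof -
  have "(\<Sum>q<m. Y p q * (v q - (if q = j then (\<Sum>q<m. Y i q * v q) / Y i j else 0)))
    = (\<Sum>q<m. Y p q * v q - (if q = j then Y p j * ((\<Sum>q<m. Y i q * v q) / Y i j) else 0))"
    by (intro sum.cong) (auto simp: algebra_simps)
  also have "\<dots> = (\<Sum>q<m. Y p q * v q) - Y p j * ((\<Sum>q<m. Y i q * v q) / Y i j)"
    using assms by (simp add: sum_subtractf)
  also have "\<dots> = (\<Sum>q<m. Y p q * v q - Y p j * (Y i q * v q / Y i j))"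
    by (simp add: sum_subtractf sum_distrib_left sum_divide_distrib)
  finally show ?thesis unfolding deflate_def by (simp add: algebra_simps)
qed

lemma top_determines_deflate:
  assumes Y: "top_determines a l m Y" and "j < m"
  shows "top_determines a l m (deflate (i, j) Y)"
  unfolding top_determines_def sum_deflate[OF assms(2)]
proof (rule allI, rule impI)
  fix v
  let ?v = "\<lambda>q. v q - (if q = j then (\<Sum>q<m. Y i q * v q) / Y i j else 0)"
  assume "\<forall>p<a. (\<Sum>q<m. Y p q * ?v q) = 0"
  then show "\<forall>p<l. (\<Sum>q<m. Y p q * ?v q) = 0"
    by (rule Y[unfolded top_determines_def, THEN spec, THEN mp])
qed

lemma top_determines_fold:
  assumes "set ps \<subseteq> UNIV \<times> {..<m}" "top_determines a l m Y"
  shows "top_determines a l m (fold deflate ps Y)"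
  using assms by (induction ps arbitrary: Y) (auto intro!: top_determines_deflate)

text \<open>A step on the transpose is a step with the indices of the pivot swapped, so the column
  argument applies to the row space as well.\<close>

lemma top_determines_fold_transpose:
  assumes "set ps \<subseteq> {..<l} \<times> UNIV" "top_determines a m l (\<lambda>q p. Y p q)"
  shows "top_determines a m l (\<lambda>q p. fold deflate ps Y p q)"
  using assms
proof (induction ps arbitrary: Y)
  case (Cons ij ps)
  obtain i j where ij: "ij = (i, j)" "i < l" using Cons.prems by (cases ij) auto
  have "top_determines a m l (\<lambda>q p. deflate ij Y p q)"
    unfolding ij(1) deflate_transpose using top_determines_deflate[OF Cons.prems(2) ij(2)] .
  with Cons show ?case by simp
qed simp

text \<open>The correction at \<open>(p, j)\<close> has the entry of the pivot row in column
  \<open>j\<close> as a factor, which is zero. Cleared columns of the corner thus stay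
  cleared.\<close>

lemma fold_deflate_column_zero:
  assumes "set ps \<subseteq> {..<a} \<times> UNIV" "\<And>p. p < a \<Longrightarrow> Y p j = 0" "p < a"
  shows "fold deflate ps Y p j = 0"
  using assms by (induction ps arbitrary: Y) (auto simp: deflate_def)

lemma sweep_column:
  assumes "p < n"
  shows "fold deflate (map (\<lambda>i. (i, j)) [0..<n]) Y p j = 0"
  using assms
proof (induction n arbitrary: p)
  case (Suc n)
  let ?Y = "fold deflate (map (\<lambda>i. (i, j)) [0..<n]) Y"
  \<comment> \<open>A zero pivot changes nothing, and the entries up to row \<open>n\<close> are
    zero already; a nonzero pivot clears all of column \<open>j\<close>.\<close>
  have "deflate (n, j) ?Y p j = 0"
    using Suc by (cases "?Y n j = 0") (auto simp: deflate_def less_Suc_eq)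
  then show ?case by simp
qed simp

text \<open>Each sweep clears its own column and keeps the earlier ones clear. This works for every
  matrix, whatever the rank of its corner.\<close>

lemma sweep_corner:
  assumes "n \<le> a" "p < a" "j < n"
  shows "fold deflate (concat (map (\<lambda>j. map (\<lambda>i. (i, j)) [0..<a]) [0..<n])) Y p j = 0"
  using assms
proof (induction n arbitrary: p)
  case (Suc n)
  let ?Y = "fold deflate (concat (map (\<lambda>j. map (\<lambda>i. (i, j)) [0..<a]) [0..<n])) Y"
  have "fold deflate (map (\<lambda>i. (i, n)) [0..<a]) ?Y p j = 0"
  proof (cases "j = n")
    case True
    with Suc.prems show ?thesis using sweep_column[of p a j ?Y] by simp
  next
    case False
    then have "?Y p' j = 0" if "p' < a" for p' using Suc that by simp
    then show ?thesis using Suc.prems by (intro fold_deflate_column_zero[where a = a and Y = ?Y]) auto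
  qed
  then show ?case by simp
qed simp

text \<open>Injectivity on the column space, applied to unit vectors, extends the zeros of the
  corner to the whole first \<open>a\<close> columns. Then every row starts with \<open>a\<close>
  zeros, and injectivity on the row space makes it vanish.\<close>

lemma zero_from_corner:
  assumes Y: "top_determines a l m Y" "top_determines a m l (\<lambda>q p. Y p q)" and "a \<le> m"
    and corner: "\<And>p q. p < a \<Longrightarrow> q < a \<Longrightarrow> Y p q = 0" and pq: "p < l" "q < m"
  shows "Y p q = 0"
proof -
  have left: "Y p' q' = 0" if "p' < l" "q' < a" for p' q'
  proof -
    have eq: "(\<Sum>k<m. Y i k * (if k = q' then 1 else 0)) = Y i q'" for i
      using that \<open>a \<le> m\<close> by (simp add: if_distrib[of "\<lambda>x. _ * x"] cong: if_cong)
    show ?thesis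
      using Y(1)[unfolded top_determines_def, rule_format, of "\<lambda>k. if k = q' then 1 else 0" p']
        that corner unfolding eq by auto
  qed
  have eq: "(\<Sum>k<l. Y k i * (if k = p then 1 else 0)) = Y p i" for i
    using pq by (simp add: if_distrib[of "\<lambda>x. _ * x"] cong: if_cong)
  show ?thesis
    using Y(2)[unfolded top_determines_def, rule_format, of "\<lambda>k. if k = p then 1 else 0" q]
      pq left unfolding eq by auto
qed

lemma elimination_zero:
  assumes "top_determines a l m Z" "top_determines a m l (\<lambda>q p. Z p q)" "a \<le> l" "a \<le> m"
    and "p < l" "q < m"
  shows "fold deflate (pivots a) Z p q = 0"
proof (rule zero_from_corner[where a = a and l = l and m = m])
  show "top_determines a l m (fold deflate (pivots a) Z)"
    using assms by (intro top_determines_fold) (auto simp: set_pivots)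
  show "top_determines a m l (\<lambda>q p. fold deflate (pivots a) Z p q)"
    using assms by (intro top_determines_fold_transpose) (auto simp: set_pivots)
  show "fold deflate (pivots a) Z p q = 0" if "p < a" "q < a" for p q
    unfolding pivots_def using that by (intro sweep_corner) auto
qed (use assms in auto)

section \<open>Straight-line programs\<close>

fun reads_below :: "nat \<Rightarrow> 'a instr \<Rightarrow> bool" where
  "reads_below n (IConst c) \<longleftrightarrow> True"
| "reads_below n (IAdd i j) \<longleftrightarrow> i < n \<and> j < n"
| "reads_below n (ISub i j) \<longleftrightarrow> i < n \<and> j < n"
| "reads_below n (IMul i j) \<longleftrightarrow> i < n \<and> j < n"
| "reads_below n (IDiv i j) \<longleftrightarrow> i < n \<and> j < n"

lemma wf_slp_iff:
  "wf_slp n prog outs \<longleftrightarrow>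
     (\<forall>k < length prog. reads_below (n + k) (prog ! k)) \<and> (\<forall>p \<in> set outs. p < n + length prog)"
proof -
  have "(case ins of IConst c \<Rightarrow> True | IAdd i j \<Rightarrow> i < n \<and> j < n | ISub i j \<Rightarrow> i < n \<and> j < n
       | IMul i j \<Rightarrow> i < n \<and> j < n | IDiv i j \<Rightarrow> i < n \<and> j < n) = reads_below n ins"
    for n and ins :: "'a instr" by (cases ins) auto
  then show ?thesis unfolding wf_slp_def by simp
qed

lemma wf_slp_append:
  assumes "wf_slp n xs []" "wf_slp (n + length xs) ys []"
  shows "wf_slp n (xs @ ys) []"
  unfolding wf_slp_iff
proof (intro conjI allI impI)
  fix k assume k: "k < length (xs @ ys)"
  show "reads_below (n + k) ((xs @ ys) ! k)"
  proof (cases "k < length xs")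
    case True then show ?thesis using assms(1) by (simp add: nth_append wf_slp_iff)
  next
    case False
    then show ?thesis
      using assms(2)[unfolded wf_slp_iff, THEN conjunct1, rule_format, of "k - length xs"] k
      by (simp add: nth_append)
  qed
qed simp

lemma reads_below_mono: "reads_below n ins \<Longrightarrow> n \<le> n' \<Longrightarrow> reads_below n' ins"
  by (cases ins) auto

lemma wf_slp_parallel:
  assumes "\<And>ins. ins \<in> set seg \<Longrightarrow> reads_below n ins"
  shows "wf_slp n seg []"
  using reads_below_mono[OF assms[OF nth_mem]] unfolding wf_slp_iff by simp

lemma run_slp_append: "run_slp (xs @ ys) mem = run_slp ys (run_slp xs mem)"
  unfolding run_slp_def by simp

lemma exec_instr_append: "reads_below (length mem) ins \<Longrightarrow> exec_instr (mem @ xs) ins = exec_instr mem ins"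
  by (cases ins) (auto simp: nth_append)

text \<open>No instruction of such a segment reads a result of the same segment, so all of them may
  be evaluated on the initial memory.\<close>

lemma run_slp_parallel:
  assumes "\<And>ins. ins \<in> set seg \<Longrightarrow> reads_below (length mem) ins"
  shows "run_slp seg mem = mem @ map (exec_instr mem) seg"
  using assms
proof (induction seg rule: rev_induct)
  case (snoc ins seg)
  then show ?case
    using exec_instr_append[of mem ins "map (exec_instr mem) seg"]
    by (auto simp: run_slp_append run_slp_def)
qed (simp add: run_slp_def)

section \<open>Elimination as a straight-line program on row-major storage\<close>

lemma index_less:
  fixes p q l m :: nat
  assumes "p < l" "q < m"
  shows "p * m + q < l * m"
proof -
  have "p * m + q < Suc p * m" using assms by simp
  also have "\<dots> \<le> l * m" using assms by (intro mult_le_mono1) simp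
  finally show ?thesis .
qed

lemma div_index_less: "k < l * m \<Longrightarrow> k div m < (l::nat)"
  by (simp add: less_mult_imp_div_less)

text \<open>The current matrix occupies the cells from \<open>b\<close> to \<open>b + l * m\<close>, row by row. A step computes the
  pivot row divided by the pivot, then the products, then the differences; the latter form the new block.\<close>
definition deflate_slp :: "nat \<Rightarrow> nat \<Rightarrow> nat \<Rightarrow> nat \<times> nat \<Rightarrow> 'a instr list" where
  "deflate_slp l m b = (\<lambda>(i, j).
     map (\<lambda>q. IDiv (b + (i * m + q)) (b + (i * m + j))) [0..<m] @
     map (\<lambda>k. IMul (b + (k div m * m + j)) (b + l * m + k mod m)) [0..<l * m] @
     map (\<lambda>k. ISub (b + k) (b + l * m + m + k)) [0..<l * m])"

text \<open>Memory only grows: a step appends \<open>m\<close> quotients, \<open>l * m\<close>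
  products and \<open>l * m\<close> differences, so the next block starts
  \<open>2 * (l * m) + m\<close> cells further on.\<close>

fun elim_slp :: "nat \<Rightarrow> nat \<Rightarrow> nat \<Rightarrow> (nat \<times> nat) list \<Rightarrow> 'a instr list" where
  "elim_slp l m b [] = []"
| "elim_slp l m b (ij # ps) = deflate_slp l m b ij @ elim_slp l m (b + (2 * (l * m) + m)) ps"

text \<open>The block must end the memory, so that the positions of the cells written next are
  known.\<close>

definition holds_block :: "nat \<Rightarrow> nat \<Rightarrow> nat \<Rightarrow> 'a list \<Rightarrow> (nat \<Rightarrow> nat \<Rightarrow> 'a) \<Rightarrow> bool" where
  "holds_block l m b mem Y \<longleftrightarrow>
     length mem = b + l * m \<and> (\<forall>p<l. \<forall>q<m. mem ! (b + (p * m + q)) = Y p q)"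

lemma length_deflate_slp: "length (deflate_slp l m b ij) = 2 * (l * m) + m"
  by (cases ij) (simp add: deflate_slp_def)

lemma length_elim_slp: "length (elim_slp l m b ps) = length ps * (2 * (l * m) + m)"
  by (induction ps arbitrary: b) (simp_all add: length_deflate_slp)

context
  fixes l m b i j :: nat
  assumes ij: "i < l" "j < m"
begin

lemma pos_m: "0 < m" using ij by simp

lemma deflate_slp_reads:
  shows "\<And>ins. ins \<in> set (map (\<lambda>q. IDiv (b + (i * m + q)) (b + (i * m + j))) [0..<m])
      \<Longrightarrow> reads_below (b + l * m) ins"
    and "\<And>ins. ins \<in> set (map (\<lambda>k. IMul (b + (k div m * m + j)) (b + l * m + k mod m)) [0..<l * m])
      \<Longrightarrow> reads_below (b + l * m + m) ins"
    and "\<And>ins. ins \<in> set (map (\<lambda>k. ISub (b + k) (b + l * m + m + k)) [0..<l * m])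
      \<Longrightarrow> reads_below (b + l * m + m + l * m) ins"
proof -
  have "b + (k div m * m + j) < b + l * m + m" if "k < l * m" for k
    using index_less[OF div_index_less[OF that] ij(2)] by simp
  then show "\<And>ins. ins \<in> set (map (\<lambda>k. IMul (b + (k div m * m + j)) (b + l * m + k mod m)) [0..<l * m])
      \<Longrightarrow> reads_below (b + l * m + m) ins" using pos_m by auto
qed (use index_less[OF ij(1)] ij in auto)

lemma wf_deflate_slp: "wf_slp (b + l * m) (deflate_slp l m b (i, j)) []"
  unfolding deflate_slp_def prod.case
  by (intro wf_slp_append wf_slp_parallel) (use deflate_slp_reads in \<open>simp_all add: add.assoc\<close>)

lemma run_deflate_slp:
  assumes mem: "holds_block l m b mem Y"
  shows "holds_block l m (b + (2 * (l * m) + m)) (run_slp (deflate_slp l m b (i, j)) mem) (deflate (i, j) Y)"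
proof -
  define s1 s2 s3 :: "'a instr list" where
    "s1 = map (\<lambda>q. IDiv (b + (i * m + q)) (b + (i * m + j))) [0..<m]" and
    "s2 = map (\<lambda>k. IMul (b + (k div m * m + j)) (b + l * m + k mod m)) [0..<l * m]" and
    "s3 = map (\<lambda>k. ISub (b + k) (b + l * m + m + k)) [0..<l * m]"
  have len: "length mem = b + l * m" and Y: "\<And>p q. p < l \<Longrightarrow> q < m \<Longrightarrow> mem ! (b + (p * m + q)) = Y p q"
    using mem unfolding holds_block_def by auto
  \<comment> \<open>The memories after the quotients, the products and the differences. Below,
    \<open>e1\<close> and \<open>e2\<close> read the new cells, while \<open>o1\<close> and
    \<open>o2\<close> say that the original block persists.\<close>
  define mem1 where "mem1 = mem @ map (exec_instr mem) s1"
  define mem2 where "mem2 = mem1 @ map (exec_instr mem1) s2"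
  define mem3 where "mem3 = mem2 @ map (exec_instr mem2) s3"
  have len1: "length mem1 = b + l * m + m" unfolding mem1_def s1_def using len by simp
  have len2: "length mem2 = b + l * m + m + l * m" unfolding mem2_def s2_def using len1 by simp
  have r1: "run_slp s1 mem = mem1"
    unfolding mem1_def s1_def by (rule run_slp_parallel) (use deflate_slp_reads(1) len in simp)
  have r2: "run_slp s2 mem1 = mem2"
    unfolding mem2_def s2_def by (rule run_slp_parallel) (use deflate_slp_reads(2) len1 in simp)
  have r3: "run_slp s3 mem2 = mem3"
    unfolding mem3_def s3_def by (rule run_slp_parallel) (use deflate_slp_reads(3) len2 in simp)
  have run: "run_slp (deflate_slp l m b (i, j)) mem = mem3"
    using r1 r2 r3 unfolding deflate_slp_def s1_def s2_def s3_def by (simp add: run_slp_append)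
  have e1: "mem1 ! (b + l * m + q) = Y i q / Y i j" if "q < m" for q
    using that ij Y unfolding mem1_def s1_def by (simp add: nth_append len)
  have o1: "mem1 ! k = mem ! k" if "k < b + l * m" for k
    using that unfolding mem1_def by (simp add: nth_append len)
  have e2: "mem2 ! (b + l * m + m + (p * m + q)) = Y p j * (Y i q / Y i j)" if "p < l" "q < m" for p q
    using that ij e1 Y o1[of "b + (p * m + j)"] index_less[OF that] index_less[OF that(1) ij(2)]
    unfolding mem2_def s2_def by (simp add: nth_append len1)
  have o2: "mem2 ! k = mem ! k" if "k < b + l * m" for k
    using that o1 unfolding mem2_def by (simp add: nth_append len1)
  have "mem3 ! (b + (2 * (l * m) + m) + (p * m + q)) = deflate (i, j) Y p q" if "p < l" "q < m" for p q
  proof -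
    have "mem3 ! (length mem2 + (p * m + q)) = map (exec_instr mem2) s3 ! (p * m + q)"
      unfolding mem3_def nth_append_length_plus ..
    also have "\<dots> = mem2 ! (b + (p * m + q)) - mem2 ! (b + l * m + m + (p * m + q))"
      using index_less[OF that] unfolding s3_def by simp
    also have "\<dots> = deflate (i, j) Y p q"
      using e2[OF that] o2[of "b + (p * m + q)"] Y[OF that] index_less[OF that] by (simp add: deflate_def)
    finally have "mem3 ! (length mem2 + (p * m + q)) = deflate (i, j) Y p q" .
    moreover have "b + (2 * (l * m) + m) + (p * m + q) = length mem2 + (p * m + q)" using len2 by simp
    ultimately show ?thesis by (simp only:)
  qed
  moreover have "length mem3 = b + (2 * (l * m) + m) + l * m"
    unfolding mem3_def s3_def using len2 by simp
  ultimately show ?thesis unfolding run holds_block_def by blast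
qed

end

lemma wf_elim_slp:
  assumes "set ps \<subseteq> {..<l} \<times> {..<m}"
  shows "wf_slp (b + l * m) (elim_slp l m b ps :: 'a instr list) []"
  using assms
proof (induction ps arbitrary: b)
  case (Cons ij ps)
  obtain i j where ij: "ij = (i, j)" "i < l" "j < m" using Cons.prems by (cases ij) auto
  have eq: "b + (2 * (l * m) + m) + l * m = b + l * m + length (deflate_slp l m b ij :: 'a instr list)"
    by (simp add: length_deflate_slp)
  have "wf_slp (b + l * m) (deflate_slp l m b ij :: 'a instr list) []" unfolding ij(1) by (rule wf_deflate_slp[OF ij(2,3)])
  moreover have "wf_slp (b + l * m + length (deflate_slp l m b ij :: 'a instr list))
      (elim_slp l m (b + (2 * (l * m) + m)) ps :: 'a instr list) []"
    unfolding eq[symmetric] by (rule Cons.IH) (use Cons.prems in simp)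
  ultimately show ?case using wf_slp_append by simp
qed (simp add: wf_slp_iff)

lemma run_elim_slp:
  assumes "set ps \<subseteq> {..<l} \<times> {..<m}" "holds_block l m b mem Y"
  shows "holds_block l m (b + length ps * (2 * (l * m) + m)) (run_slp (elim_slp l m b ps) mem)
    (fold deflate ps Y)"
  using assms
proof (induction ps arbitrary: b mem Y)
  case (Cons ij ps)
  obtain i j where ij: "ij = (i, j)" "i < l" "j < m" using Cons.prems by (cases ij) auto
  have "holds_block l m (b + (2 * (l * m) + m)) (run_slp (deflate_slp l m b ij) mem) (deflate ij Y)"
    using run_deflate_slp[OF ij(2,3) Cons.prems(2)] ij(1) by simp
  from Cons.IH[OF _ this] Cons.prems show ?case by (simp add: run_slp_append algebra_simps)
qed (simp add: run_slp_def)

lemma nth_concat_map_upt: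
  assumes "p < l" "q < m"
  shows "concat (map (\<lambda>i. map (f i) [0..<m]) [0..<l]) ! (p * m + q) = f p q"
  using assms
proof (induction l)
  case (Suc l)
  let ?c = "concat (map (\<lambda>i. map (f i) [0..<m]) [0..<l])"
  have len: "length ?c = l * m" by (simp add: length_concat o_def sum_list_triv)
  show ?case
  proof (cases "p < l")
    case True
    then show ?thesis using Suc index_less[of p l q m] len by (simp add: nth_append)
  next
    case False
    then have "p = l" using Suc.prems by simp
    then show ?thesis using Suc.prems len by (simp add: nth_append)
  qed
qed simp

lemma mat_to_list_alt: "mat_to_list A = concat (map (\<lambda>i. map (\<lambda>j. A $$ (i, j)) [0..<dim_col A]) [0..<dim_row A])"
  unfolding mat_to_list_def by (simp add: concat_map_singleton)

lemma holds_block_mat_to_list: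
  assumes "y \<in> carrier_mat l m" "\<And>p q. p < l \<Longrightarrow> q < m \<Longrightarrow> Y p q = y $$ (p, q)"
  shows "holds_block l m 0 (mat_to_list y) Y"
  using assms nth_concat_map_upt[of _ l _ m "\<lambda>i j. y $$ (i, j)"]
  unfolding holds_block_def mat_to_list_alt by (auto simp: length_concat o_def sum_list_triv)

definition elim_outs :: "nat \<Rightarrow> nat \<Rightarrow> nat \<Rightarrow> nat list" where
  "elim_outs l m n = map (\<lambda>k. n * (2 * (l * m) + m) + k) [0..<l * m]"

lemma wf_elim_decoder:
  assumes "set ps \<subseteq> {..<l} \<times> {..<m}"
  shows "wf_slp (l * m) (elim_slp l m 0 ps) (elim_outs l m (length ps))"
  using wf_elim_slp[OF assms, of 0] by (auto simp: wf_slp_iff elim_outs_def length_elim_slp)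

lemma elim_decoder_index:
  assumes "y \<in> carrier_mat l m" "\<And>p q. p < l \<Longrightarrow> q < m \<Longrightarrow> Y p q = y $$ (p, q)"
    and "set ps \<subseteq> {..<l} \<times> {..<m}" and "p < l" "q < m"
  shows "slp_decode l m (elim_slp l m 0 ps) (elim_outs l m (length ps)) y $$ (p, q) = fold deflate ps Y p q"
  using run_elim_slp[OF assms(3) holds_block_mat_to_list[OF assms(1,2)]] assms(4,5) index_less[OF assms(4,5)]
  unfolding slp_decode_def holds_block_def elim_outs_def by (auto simp: Let_def)

section \<open>Counting noise matrices with a degenerate corner\<close>

lemma finite_carrier_vec: "finite (carrier_vec n :: 'a::finite vec set)"
  and card_carrier_vec: "card (carrier_vec n :: 'a::finite vec set) = CARD('a) ^ n"
proof -
  let ?L = "{xs :: 'a list. set xs \<subseteq> UNIV \<and> length xs = n}"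
  have "bij_betw vec_of_list ?L (carrier_vec n)"
    by (intro bij_betwI[where g = list_of_vec]) (auto intro!: carrier_vecI simp: vec_list list_vec)
  note bij = this
  show "finite (carrier_vec n :: 'a vec set)"
    using bij_betw_finite[OF bij] finite_lists_length_eq[of "UNIV :: 'a set" n] by simp
  show "card (carrier_vec n :: 'a vec set) = CARD('a) ^ n"
    using bij_betw_same_card[OF bij] card_lists_length_eq[of "UNIV :: 'a set" n] by simp
qed

lemma finite_carrier_mat: "finite (carrier_mat l m :: 'a::finite mat set)"
proof (rule finite_subset)
  show "carrier_mat l m \<subseteq> (\<lambda>f. mat l m f) ` (({..<l} \<times> {..<m}) \<rightarrow>\<^sub>E (UNIV :: 'a set))"
  proof
    fix A :: "'a mat" assume A: "A \<in> carrier_mat l m"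
    then show "A \<in> (\<lambda>f. mat l m f) ` (({..<l} \<times> {..<m}) \<rightarrow>\<^sub>E (UNIV :: 'a set))"
      by (intro image_eqI[where x = "restrict (\<lambda>ij. A $$ ij) ({..<l} \<times> {..<m})"] eq_matI) auto
  qed
qed (simp add: finite_PiE)

lemma finite_noise_set: "finite (noise_set l m r :: 'a::{finite, field} mat set)"
  unfolding noise_set_def by (simp add: finite_carrier_mat)

text \<open>Two hyperplanes never cover the space. Either one coordinate is nonzero on both vectors,
  or a sum of two coordinate functionals is; scaling gives the value 1 at \<open>w\<close>.\<close>

lemma exists_separating_functional:
  fixes w w' :: "'a::field vec"
  assumes w: "w \<in> carrier_vec n" "w \<noteq> 0\<^sub>v n" and w': "w' \<in> carrier_vec n" "w' \<noteq> 0\<^sub>v n"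
  obtains f where "f \<in> carrier_vec n" "f \<bullet> w = 1" "f \<bullet> w' \<noteq> 0"
proof -
  obtain i where i: "i < n" "w $ i \<noteq> 0" using w by (metis carrier_vecD eq_vecI index_zero_vec)
  obtain j where j: "j < n" "w' $ j \<noteq> 0" using w' by (metis carrier_vecD eq_vecI index_zero_vec)
  have unit: "unit_vec n k \<bullet> u = u $ k" if "u \<in> carrier_vec n" "k < n" for u :: "'a vec" and k
    using that by simp
  consider "w' $ i \<noteq> 0" | "w $ j \<noteq> 0" | "w' $ i = 0" "w $ j = 0" by blast
  then show thesis
  proof cases
    case 1
    show thesis by (rule that[of "(1 / w $ i) \<cdot>\<^sub>v unit_vec n i"]) (use 1 i w w' unit in auto)
  next
    case 2
    show thesis by (rule that[of "(1 / w $ j) \<cdot>\<^sub>v unit_vec n j"]) (use 2 j w w' unit in auto)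
  next
    case 3
    have dot: "((1 / w $ i) \<cdot>\<^sub>v unit_vec n i + unit_vec n j) \<bullet> u = u $ i / w $ i + u $ j"
      if "u \<in> carrier_vec n" for u
      using that i j unit by (subst add_scalar_prod_distrib[where n = n]) auto
    show thesis
      by (rule that[of "(1 / w $ i) \<cdot>\<^sub>v unit_vec n i + unit_vec n j"]) (use 3 i j w w' dot in auto)
  qed
qed

text \<open>The transvection-like matrix \<open>1 + (w' - w) f\<^sup>T\<close> with \<open>f w = 1\<close> and \<open>f w' \<noteq> 0\<close>, whose inverse is
  \<open>1 - (w' - w) f\<^sup>T / f w'\<close>.\<close>
lemma general_linear_transitive:
  fixes w w' :: "'a::field vec"
  assumes w: "w \<in> carrier_vec n" "w \<noteq> 0\<^sub>v n" and w': "w' \<in> carrier_vec n" "w' \<noteq> 0\<^sub>v n"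
  obtains P P' where "P \<in> carrier_mat n n" "P' \<in> carrier_mat n n" "P' * P = 1\<^sub>m n" "P *\<^sub>v w = w'"
proof -
  obtain f where f: "f \<in> carrier_vec n" "f \<bullet> w = 1" "f \<bullet> w' \<noteq> 0"
    using exists_separating_functional[OF w w'] .
  define u where "u = w' - w"
  have u: "u \<in> carrier_vec n" using w w' by (simp add: u_def)
  define c where "c = f \<bullet> w'"
  have fu: "(\<Sum>k<n. f $ k * u $ k) = c - 1"
  proof -
    have "f \<bullet> u = f \<bullet> w' - f \<bullet> w" unfolding u_def using f w w' by (simp add: scalar_prod_minus_distrib)
    then show ?thesis using u f by (simp add: scalar_prod_def c_def atLeast0LessThan)
  qed
  define \<delta> where "\<delta> i k = (if i = k then 1 else 0 :: 'a)" for i k :: nat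
  define P where "P = mat n n (\<lambda>(i, k). \<delta> i k + u $ i * f $ k)"
  define P' where "P' = mat n n (\<lambda>(i, k). \<delta> i k - u $ i * f $ k / c)"
  have P: "P \<in> carrier_mat n n" "P' \<in> carrier_mat n n" by (simp_all add: P_def P'_def)
  have "P *\<^sub>v w = w'"
  proof (rule eq_vecI)
    fix i assume "i < dim_vec w'"
    then have i: "i < n" using w' by simp
    have "(P *\<^sub>v w) $ i = (\<Sum>k<n. \<delta> i k * w $ k + u $ i * (f $ k * w $ k))"
      using i w P by (auto simp: scalar_prod_def P_def atLeast0LessThan algebra_simps intro!: sum.cong)
    also have "\<dots> = w $ i + u $ i * (f \<bullet> w)"
      using i w by (simp add: sum.distrib \<delta>_def scalar_prod_def atLeast0LessThan if_distrib[of "\<lambda>x. x * _"]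
          flip: sum_distrib_left cong: if_cong)
    also have "\<dots> = w' $ i" using f i w w' by (simp add: u_def)
    finally show "(P *\<^sub>v w) $ i = w' $ i" .
  qed (use w' P in simp)
  moreover have "P' * P = 1\<^sub>m n"
  proof (rule eq_matI)
    fix i j assume "i < dim_row (1\<^sub>m n :: 'a mat)" "j < dim_col (1\<^sub>m n :: 'a mat)"
    then have ij: "i < n" "j < n" by auto
    have "(P' * P) $$ (i, j) = (\<Sum>k<n. (\<delta> i k - u $ i * f $ k / c) * (\<delta> k j + u $ k * f $ j))"
      using ij by (simp add: P_def P'_def scalar_prod_def atLeast0LessThan)
    also have "\<dots> = (\<Sum>k<n. \<delta> i k * (\<delta> k j + u $ k * f $ j))
        - (\<Sum>k<n. \<delta> k j * (u $ i * f $ k / c)) - u $ i * f $ j / c * (\<Sum>k<n. f $ k * u $ k)"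
    proof -
      have "(\<delta> i k - u $ i * f $ k / c) * (\<delta> k j + u $ k * f $ j) = \<delta> i k * (\<delta> k j + u $ k * f $ j)
          - \<delta> k j * (u $ i * f $ k / c) - u $ i * f $ j / c * (f $ k * u $ k)" for k
        by (simp add: algebra_simps)
      then show ?thesis by (simp only: sum_subtractf sum_distrib_left)
    qed
    also have "(\<Sum>k<n. \<delta> i k * (\<delta> k j + u $ k * f $ j)) = \<delta> i j + u $ i * f $ j"
      using ij by (simp add: \<delta>_def if_distrib[of "\<lambda>x. x * _"] cong: if_cong)
    also have "(\<Sum>k<n. \<delta> k j * (u $ i * f $ k / c)) = u $ i * f $ j / c"
      using ij by (simp add: \<delta>_def if_distrib[of "\<lambda>x. x * _"] if_distrib[of "\<lambda>x. x / _"] cong: if_cong)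
    \<comment> \<open>The coefficient of \<open>u $ i * f $ j\<close> is
      \<open>1 - 1 / c - (c - 1) / c\<close>, which is zero.\<close>
    also have "\<delta> i j + u $ i * f $ j - u $ i * f $ j / c - u $ i * f $ j / c * (\<Sum>k<n. f $ k * u $ k) = \<delta> i j"
      unfolding fu using f(3) by (simp add: c_def field_simps)
    finally show "(P' * P) $$ (i, j) = 1\<^sub>m n $$ (i, j)" using ij by (simp add: \<delta>_def)
  qed (use P in simp_all)
  ultimately show thesis using that P by blast
qed

section \<open>Column spaces of noise matrices\<close>

definition column_space :: "'a::field mat \<Rightarrow> 'a vec set" where
  "column_space A = (\<lambda>v. A *\<^sub>v v) ` carrier_vec (dim_col A)"

lemma column_space_subset: "A \<in> carrier_mat l m \<Longrightarrow> column_space A \<subseteq> carrier_vec l"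
  unfolding column_space_def by auto

text \<open>A rank factorisation puts the column space inside the image of \<open>U\<close>, which
  has at most one element for each vector of length \<open>mat_rank A\<close>.\<close>

lemma card_column_space_le:
  fixes A :: "'a::{finite, field} mat"
  assumes A: "A \<in> carrier_mat l m"
  shows "card (column_space A) \<le> CARD('a) ^ mat_rank A"
proof -
  obtain U V where UV: "U \<in> carrier_mat l (mat_rank A)" "V \<in> carrier_mat (mat_rank A) m" "A = U * V"
    using mat_rank_factorisation[OF A] .
  have "column_space A \<subseteq> (\<lambda>v. U *\<^sub>v v) ` carrier_vec (mat_rank A)"
    unfolding column_space_def
  proof (rule image_subsetI)
    fix v :: "'a vec" assume "v \<in> carrier_vec (dim_col A)"
    then have v: "v \<in> carrier_vec m" using A by simp
    have "A *\<^sub>v v = (U * V) *\<^sub>v v" using UV(3) by simp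
    also have "\<dots> = U *\<^sub>v (V *\<^sub>v v)" by (rule assoc_mult_mat_vec[OF UV(1,2) v])
    finally show "A *\<^sub>v v \<in> (\<lambda>v. U *\<^sub>v v) ` carrier_vec (mat_rank A)" using UV(2) v by auto
  qed
  then have "card (column_space A) \<le> card ((\<lambda>v. U *\<^sub>v v) ` carrier_vec (mat_rank A))"
    by (intro card_mono finite_imageI finite_carrier_vec)
  also have "\<dots> \<le> card (carrier_vec (mat_rank A) :: 'a vec set)" by (intro card_image_le finite_carrier_vec)
  finally show ?thesis by (simp add: card_carrier_vec)
qed

text \<open>Multiplication by an invertible \<open>P\<close> taking \<open>w\<close> to
  \<open>w'\<close> is injective, preserves the rank (neither \<open>P\<close> nor \<open>P'\<close>
  raises it) and carries column spaces along. Exchanging \<open>w\<close> and \<open>w'\<close>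
  makes the two counts equal.\<close>

lemma card_noise_containing_le:
  fixes w w' :: "'a::{finite, field} vec"
  assumes "w \<in> carrier_vec l" "w \<noteq> 0\<^sub>v l" "w' \<in> carrier_vec l" "w' \<noteq> 0\<^sub>v l"
  shows "card {z \<in> noise_set l m r. w \<in> column_space z} \<le> card {z \<in> noise_set l m r. w' \<in> column_space z}"
proof -
  obtain P P' where P: "P \<in> carrier_mat l l" "P' \<in> carrier_mat l l" "P' * P = 1\<^sub>m l" "P *\<^sub>v w = w'"
    using general_linear_transitive[OF assms] .
  have inv: "P' * (P * z) = z" if "z \<in> carrier_mat l m" for z
    using assoc_mult_mat[OF P(2,1) that] P(3) that by simp
  show ?thesis
  proof (rule card_inj_on_le)
    show "inj_on (\<lambda>z. P * z) {z \<in> noise_set l m r. w \<in> column_space z}"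
      by (rule inj_on_inverseI[where g = "\<lambda>z. P' * z"]) (auto simp: inv noise_set_def)
    show "(\<lambda>z. P * z) ` {z \<in> noise_set l m r. w \<in> column_space z} \<subseteq> {z \<in> noise_set l m r. w' \<in> column_space z}"
    proof (rule image_subsetI)
      fix z assume "z \<in> {z \<in> noise_set l m r. w \<in> column_space z}"
      then have z: "z \<in> carrier_mat l m" "mat_rank z = r" "w \<in> column_space z"
        by (auto simp: noise_set_def)
      have Pz: "P * z \<in> carrier_mat l m" using P z by simp
      have "mat_rank (P * z) \<le> mat_rank z" by (rule mat_rank_mult_left_le[OF P(1) z(1)])
      moreover have "mat_rank z \<le> mat_rank (P * z)"
        using mat_rank_mult_left_le[OF P(2) Pz] inv[OF z(1)] by simp
      ultimately have rank: "mat_rank (P * z) = r" using z(2) by simp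
      obtain v where v: "v \<in> carrier_vec m" "w = z *\<^sub>v v" using z by (auto simp: column_space_def)
      then have "w' = (P * z) *\<^sub>v v" using P(4) assoc_mult_mat_vec[OF P(1) z(1) v(1)] by simp
      then have "w' \<in> column_space (P * z)" unfolding column_space_def using v(1) Pz by auto
      with Pz rank show "P * z \<in> {z \<in> noise_set l m r. w' \<in> column_space z}" by (simp add: noise_set_def)
    qed
  qed (simp add: finite_noise_set)
qed

text \<open>These are the nonzero vectors of length \<open>l - a\<close> padded with zeros in
  front.\<close>

lemma card_vectors_with_zero_prefix:
  assumes "a \<le> l"
  shows "card {w \<in> carrier_vec l - {0\<^sub>v l} :: 'a vec set. \<forall>p<a. w $ p = 0} \<le> CARD('a::{finite, field}) ^ (l - a) - 1"
    (is "card ?B \<le> _")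
proof -
  let ?V = "carrier_vec (l - a) - {0\<^sub>v (l - a)} :: 'a vec set"
  have "?B \<subseteq> (\<lambda>v. 0\<^sub>v a @\<^sub>v v) ` ?V"
  proof
    fix w :: "'a vec" assume w: "w \<in> ?B"
    define v where "v = vec (l - a) (\<lambda>p. w $ (a + p))"
    have "w = 0\<^sub>v a @\<^sub>v v" using w assms by (intro eq_vecI) (auto simp: v_def append_vec_def)
    moreover have "v \<noteq> 0\<^sub>v (l - a)"
    proof
      assume "v = 0\<^sub>v (l - a)"
      then have "w = 0\<^sub>v l" using \<open>w = 0\<^sub>v a @\<^sub>v v\<close> assms by (intro eq_vecI) (auto simp: append_vec_def)
      then show False using w by simp
    qed
    moreover have "v \<in> carrier_vec (l - a)" by (simp add: v_def)
    ultimately show "w \<in> (\<lambda>v. 0\<^sub>v a @\<^sub>v v) ` ?V" by blast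
  qed
  then have "card ?B \<le> card ((\<lambda>v. 0\<^sub>v a @\<^sub>v v) ` ?V)" by (intro card_mono) (simp_all add: finite_carrier_vec)
  also have "\<dots> \<le> card ?V" by (intro card_image_le) (simp add: finite_carrier_vec)
  also have "\<dots> = CARD('a) ^ (l - a) - 1" by (simp add: card_Diff_singleton card_carrier_vec)
  finally show ?thesis .
qed

text \<open>Double counting: every nonzero vector lies in the column space of equally many noise matrices,
  and each column space has at most \<open>q\<^sup>r\<close> elements.\<close>
lemma card_noise_not_top_determined:
  assumes "r + s \<le> l"
  shows "card {z \<in> noise_set l m r :: 'a mat set. \<not> top_determines (r + s) l m (\<lambda>p q. z $$ (p, q))} * CARD('a) ^ s
    \<le> card (noise_set l m r :: 'a::{finite, field} mat set)"
proof -
  let ?q = "CARD('a)"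
  define Z where "Z = (noise_set l m r :: 'a mat set)"
  define T where "T = (carrier_vec l - {0\<^sub>v l} :: 'a vec set)"
  define B where "B = {w \<in> T. \<forall>p<r + s. w $ p = 0}"
  define bad where "bad = {z \<in> Z. \<not> top_determines (r + s) l m (\<lambda>p q. z $$ (p, q))}"
  have finZ: "finite Z" unfolding Z_def by (rule finite_noise_set)
  have finT: "finite T" unfolding T_def by (simp add: finite_carrier_vec)
  have finB: "finite B" unfolding B_def using finT by simp
  have q: "1 \<le> ?q" using finite_UNIV_card_ge_0[where 'a = 'a] by simp
  have cardT: "card T = ?q ^ l - 1" unfolding T_def by (simp add: card_Diff_singleton card_carrier_vec)
  \<comment> \<open>A projection that fails to be injective sends some nonzero vector of the column
    space to zero, and this vector lies in \<open>B\<close>.\<close>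
  have bad_sub: "bad \<subseteq> (\<Union>w\<in>B. {z \<in> Z. w \<in> column_space z})"
  proof
    fix z assume "z \<in> bad"
    then have z: "z \<in> Z" "z \<in> carrier_mat l m" "\<not> top_determines (r + s) l m (\<lambda>p q. z $$ (p, q))"
      by (auto simp: bad_def Z_def noise_set_def)
    then obtain v p where v: "\<forall>p<r + s. (\<Sum>q<m. z $$ (p, q) * v q) = 0"
      and p: "p < l" "(\<Sum>q<m. z $$ (p, q) * v q) \<noteq> 0" unfolding top_determines_def by blast
    define w where "w = z *\<^sub>v vec m v"
    have w: "w $ p = (\<Sum>q<m. z $$ (p, q) * v q)" if "p < l" for p
      using that z(2) unfolding w_def by (auto simp: scalar_prod_def atLeast0LessThan intro!: sum.cong)
    have "w \<in> carrier_vec l" unfolding w_def using z(2) by simp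
    moreover have "w \<noteq> 0\<^sub>v l" using w[OF p(1)] p by auto
    ultimately have "w \<in> B" unfolding B_def T_def using w v assms by auto
    moreover have "w \<in> column_space z" unfolding column_space_def w_def using z(2) by auto
    ultimately show "z \<in> (\<Union>w\<in>B. {z \<in> Z. w \<in> column_space z})" using z(1) by blast
  qed
  have "card bad * ?q ^ s \<le> card Z"
  \<comment> \<open>Only \<open>l = 0\<close> leaves \<open>T\<close> empty; otherwise the factor
    \<open>card T\<close> can be cancelled at the end.\<close>
  proof (cases "T = {}")
    case True
    then have "bad = {}" using bad_sub unfolding B_def by auto
    then show ?thesis by simp
  next
    case False
    then obtain w0 where w0: "w0 \<in> T" by blast
    define c where "c = card {z \<in> Z. w0 \<in> column_space z}"
    have c: "card {z \<in> Z. w \<in> column_space z} = c" if "w \<in> T" for w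
      using that w0 card_noise_containing_le[of _ l _ m r] unfolding c_def Z_def T_def
      by (intro antisym) auto
    \<comment> \<open>The pairs of a noise matrix and a nonzero vector of its column space are
      counted in two ways.\<close>
    have "(\<Sum>z\<in>Z. card {w \<in> T. w \<in> column_space z}) = (\<Sum>w\<in>T. c)"
      by (rule sum_multicount_gen[OF finZ finT]) (use c in blast)
    moreover have "card {w \<in> T. w \<in> column_space z} \<le> ?q ^ r - 1" if "z \<in> Z" for z
    proof -
      have z: "z \<in> carrier_mat l m" "mat_rank z = r" using that by (auto simp: Z_def noise_set_def)
      have fin: "finite (column_space z)"
        using finite_subset[OF column_space_subset[OF z(1)] finite_carrier_vec] .
      have "0\<^sub>v l \<in> column_space z" unfolding column_space_def using z
        by (intro image_eqI[where x = "0\<^sub>v m"]) auto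
      moreover have "{w \<in> T. w \<in> column_space z} \<subseteq> column_space z - {0\<^sub>v l}" unfolding T_def by auto
      ultimately have "card {w \<in> T. w \<in> column_space z} \<le> card (column_space z) - 1"
        using card_mono[OF _ \<open>{w \<in> T. w \<in> column_space z} \<subseteq> column_space z - {0\<^sub>v l}\<close>] fin
        by (simp add: card_Diff_singleton)
      then show ?thesis using card_column_space_le[OF z(1)] z(2) by simp
    qed
    then have "(\<Sum>z\<in>Z. card {w \<in> T. w \<in> column_space z}) \<le> (\<Sum>z\<in>Z. ?q ^ r - 1)" by (rule sum_mono)
    ultimately have cT: "c * card T \<le> card Z * (?q ^ r - 1)" by (simp add: mult.commute)
    have "card bad \<le> card (\<Union>w\<in>B. {z \<in> Z. w \<in> column_space z})"
      by (rule card_mono[OF _ bad_sub]) (use finB finZ in simp)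
    also have "\<dots> \<le> (\<Sum>w\<in>B. card {z \<in> Z. w \<in> column_space z})" by (rule card_UN_le[OF finB])
    also have "\<dots> = (\<Sum>w\<in>B. c)" by (intro sum.cong) (auto simp: c B_def)
    also have "\<dots> = card B * c" by simp
    also have "\<dots> \<le> (?q ^ (l - (r + s)) - 1) * c"
      using card_vectors_with_zero_prefix[OF assms, where 'a = 'a] unfolding B_def T_def
      by (intro mult_right_mono) auto
    finally have badc: "card bad \<le> (?q ^ (l - (r + s)) - 1) * c" .
    \<comment> \<open>Each of the at most \<open>q^(l-r-s) - 1\<close> vectors of \<open>B\<close>
      lies in the column space of at most a fraction \<open>(q^r - 1) / (q^l - 1)\<close> of the
      noise; this inequality bounds the product by \<open>q^(-s)\<close>.\<close>
    have arith: "?q ^ s * ((?q ^ (l - (r + s)) - 1) * (?q ^ r - 1)) \<le> card T"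
    proof -
      have "?q ^ s * ((?q ^ (l - (r + s)) - 1) * (?q ^ r - 1)) \<le> ?q ^ s * ((?q ^ (l - (r + s)) - 1) * ?q ^ r)"
        by (intro mult_left_mono) auto
      also have "\<dots> = ?q ^ (r + s + (l - (r + s))) - ?q ^ (r + s)"
        by (simp add: power_add algebra_simps diff_mult_distrib diff_mult_distrib2)
      also have "\<dots> \<le> ?q ^ l - 1" using assms q by (simp add: diff_le_mono2)
      finally show ?thesis using cardT by simp
    qed
    have "card bad * ?q ^ s * card T \<le> (?q ^ (l - (r + s)) - 1) * c * ?q ^ s * card T"
      using badc by (intro mult_right_mono) auto
    also have "\<dots> = ?q ^ s * (?q ^ (l - (r + s)) - 1) * (c * card T)" by (simp add: mult_ac)
    also have "\<dots> \<le> ?q ^ s * (?q ^ (l - (r + s)) - 1) * (card Z * (?q ^ r - 1))"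
      using cT by (intro mult_left_mono) auto
    also have "\<dots> = ?q ^ s * ((?q ^ (l - (r + s)) - 1) * (?q ^ r - 1)) * card Z" by (simp add: mult_ac)
    also have "\<dots> \<le> card T * card Z" using arith by (intro mult_right_mono) auto
    finally have "card bad * ?q ^ s * card T \<le> card Z * card T" by (simp add: mult_ac)
    then show ?thesis using False finT by (simp add: card_gt_0_iff)
  qed
  then show ?thesis unfolding bad_def Z_def .
qed

text \<open>Transposition preserves the rank, so it turns the row condition into the column
  condition for noise of shape \<open>m\<close> by \<open>l\<close>.\<close>

lemma card_noise_not_left_determined:
  assumes "r + s \<le> m"
  shows "card {z \<in> noise_set l m r :: 'a mat set. \<not> top_determines (r + s) m l (\<lambda>q p. z $$ (p, q))} * CARD('a) ^ s
    \<le> card (noise_set l m r :: 'a::{finite, field} mat set)"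
proof -
  have bij: "bij_betw transpose_mat (noise_set l m r :: 'a mat set) (noise_set m l r)"
    by (rule bij_betwI[where g = transpose_mat]) (auto simp: noise_set_def mat_rank_transpose)
  \<comment> \<open>Entries of the transpose agree with the swapped ones only inside the matrix, so
    the prefix has to fit: \<open>a \<le> m\<close>.\<close>
  have entry: "top_determines a m l (\<lambda>p q. z\<^sup>T $$ (p, q)) = top_determines a m l (\<lambda>q p. z $$ (p, q))"
    if "z \<in> noise_set l m r" "a \<le> m" for z :: "'a mat" and a
    using that unfolding top_determines_def by (auto simp: noise_set_def)
  have "bij_betw transpose_mat {z \<in> noise_set l m r :: 'a mat set. \<not> top_determines (r + s) m l (\<lambda>q p. z $$ (p, q))}
      {z \<in> noise_set m l r :: 'a mat set. \<not> top_determines (r + s) m l (\<lambda>p q. z $$ (p, q))}"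
    by (rule bij_betw_Collect[OF bij]) (use entry assms in blast)
  from bij_betw_same_card[OF this] bij_betw_same_card[OF bij] card_noise_not_top_determined[OF assms, of l, where 'a = 'a]
  show ?thesis by simp
qed

section \<open>The error trapping code\<close>

definition trap_code :: "nat \<Rightarrow> nat \<Rightarrow> nat \<Rightarrow> 'a::zero mat set" where
  "trap_code a l m = {x \<in> carrier_mat l m. \<forall>p<l. \<forall>q<m. p < a \<or> q < a \<longrightarrow> x $$ (p, q) = 0}"

lemma finite_trap_code: "finite (trap_code a l m :: 'a::{finite, zero} mat set)"
  by (rule finite_subset[OF _ finite_carrier_mat]) (auto simp: trap_code_def)

lemma zero_in_trap_code: "0\<^sub>m l m \<in> trap_code a l m"
  unfolding trap_code_def by simp

text \<open>Filling the block of rows and columns from \<open>a\<close> on arbitrarily gives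
  distinct codewords.\<close>

lemma card_trap_code_ge: "CARD('a) ^ ((l - a) * (m - a)) \<le> card (trap_code a l m :: 'a::{finite, zero} mat set)"
proof -
  let ?I = "{a..<l} \<times> {a..<m}"
  let ?F = "?I \<rightarrow>\<^sub>E (UNIV :: 'a set)"
  let ?mat = "\<lambda>g. mat l m (\<lambda>(p, q). if p < a \<or> q < a then 0 else g (p, q))"
  have "inj_on ?mat ?F"
  proof (rule inj_onI)
    fix g h assume gh: "g \<in> ?F" "h \<in> ?F" "?mat g = ?mat h"
    show "g = h"
    proof (rule PiE_ext[OF gh(1,2)])
      fix pq assume "pq \<in> ?I"
      then obtain p q where pq: "pq = (p, q)" "a \<le> p" "p < l" "a \<le> q" "q < m" by auto
      have "?mat g $$ (p, q) = ?mat h $$ (p, q)" using gh(3) by simp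
      then show "g pq = h pq" using pq by simp
    qed
  qed
  then have "card ?F \<le> card (trap_code a l m :: 'a mat set)"
    by (rule card_inj_on_le[OF _ _ finite_trap_code]) (auto simp: trap_code_def)
  then show ?thesis by (simp add: card_PiE)
qed

text \<open>The codeword passes through the elimination unchanged while the noise is reduced to
  zero, so the final block is the codeword itself.\<close>

lemma trap_decoder_correct:
  fixes x z :: "'a::{finite, field} mat"
  assumes x: "x \<in> trap_code a l m" and z: "z \<in> carrier_mat l m" and a: "a \<le> l" "a \<le> m"
    and rows: "top_determines a l m (\<lambda>p q. z $$ (p, q))"
    and cols: "top_determines a m l (\<lambda>q p. z $$ (p, q))"
  shows "slp_decode l m (elim_slp l m 0 (pivots a)) (elim_outs l m (a * a)) (x + z) = x"
proof (rule eq_matI)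
  \<comment> \<open>Extended by zero, since \<open>fold_offset\<close> asks for zeros at all indices
    in the first \<open>a\<close> rows and columns, also those beyond the matrix.\<close>
  define X where "X p q = (if p < l \<and> q < m then x $$ (p, q) else 0)" for p q
  define Y where "Y p q = X p q + z $$ (p, q)" for p q
  have xc: "x \<in> carrier_mat l m" using x by (simp add: trap_code_def)
  fix p q assume "p < dim_row x" "q < dim_col x"
  then have pq: "p < l" "q < m" using xc by auto
  have ps: "set (pivots a) \<subseteq> {..<l} \<times> {..<m}" using a by (auto simp: set_pivots)
  have X0: "X p q = 0" if "p < a \<or> q < a" for p q using x that by (auto simp: X_def trap_code_def)
  have "slp_decode l m (elim_slp l m 0 (pivots a)) (elim_outs l m (a * a)) (x + z) $$ (p, q)
      = fold deflate (pivots a) Y p q"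
    unfolding length_pivots[symmetric]
    by (rule elim_decoder_index[OF _ _ ps pq]) (use xc z in \<open>auto simp: X_def Y_def\<close>)
  also have "\<dots> = X p q + fold deflate (pivots a) (\<lambda>p q. z $$ (p, q)) p q"
    unfolding Y_def using fold_offset[of "pivots a" a X] X0 by (simp add: set_pivots)
  also have "\<dots> = x $$ (p, q)"
    using elimination_zero[OF rows cols a pq] pq by (simp add: X_def)
  finally show "slp_decode l m (elim_slp l m 0 (pivots a)) (elim_outs l m (a * a)) (x + z) $$ (p, q)
      = x $$ (p, q)" .
qed (use x in \<open>auto simp: slp_decode_def Let_def trap_code_def\<close>)

text \<open>Whatever the codeword, a noise matrix outside \<open>B\<close> causes no row error and
  one inside at most \<open>l\<close>.\<close>

lemma symbol_error_prob_le:
  assumes fin: "finite C" "finite Z"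
    and good: "\<And>x z. x \<in> C \<Longrightarrow> z \<in> Z \<Longrightarrow> z \<notin> B \<Longrightarrow> dec (x + z) = x"
  shows "symbol_error_prob l C Z dec \<le> real (card (Z \<inter> B)) / real (card Z)"
proof -
  have "(\<Sum>i<l. (if row (dec (x + z)) i \<noteq> row x i then 1 else 0)) \<le> (if z \<in> B then real l else 0)"
    if "x \<in> C" "z \<in> Z" for x z
  proof (cases "z \<in> B")
    case True
    have "(\<Sum>i<l. (if row (dec (x + z)) i \<noteq> row x i then 1 else 0)) \<le> (\<Sum>i<l. 1 :: real)"
      by (rule sum_mono) simp
    then show ?thesis using True by simp
  qed (use good that in simp)
  then have "(\<Sum>x\<in>C. \<Sum>z\<in>Z. \<Sum>i<l. (if row (dec (x + z)) i \<noteq> row x i then 1 else 0))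
    \<le> (\<Sum>x\<in>C. \<Sum>z\<in>Z. if z \<in> B then real l else 0)" by (intro sum_mono) blast
  also have "\<dots> = real (card C) * (real (card (Z \<inter> B)) * real l)"
    using fin by (simp flip: sum.inter_restrict)
  finally have "symbol_error_prob l C Z dec
      \<le> real (card C) * (real (card (Z \<inter> B)) * real l) / (real (card C) * real (card Z) * real l)"
    unfolding symbol_error_prob_def by (rule divide_right_mono) simp
  \<comment> \<open>For empty \<open>C\<close> or \<open>l = 0\<close> the left quotient is 0, as
    \<open>x / 0 = 0\<close>.\<close>
  also have "\<dots> \<le> real (card (Z \<inter> B)) / real (card Z)" by (cases "card C = 0"; cases "l = 0") simp_all
  finally show ?thesis .
qed

lemma trap_code_error_le:
  fixes dec :: "'a::{finite, field} mat \<Rightarrow> 'a mat"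
  assumes a: "r + s \<le> l" "r + s \<le> m"
  defines "dec \<equiv> slp_decode l m (elim_slp l m 0 (pivots (r + s))) (elim_outs l m ((r + s) * (r + s)))"
  shows "symbol_error_prob l (trap_code (r + s) l m) (noise_set l m r) dec \<le> 2 / real CARD('a) ^ s"
proof -
  let ?q = "real CARD('a)"
  define Z where "Z = (noise_set l m r :: 'a mat set)"
  define B1 where "B1 = {z \<in> Z. \<not> top_determines (r + s) l m (\<lambda>p q. z $$ (p, q))}"
  define B2 where "B2 = {z \<in> Z. \<not> top_determines (r + s) m l (\<lambda>q p. z $$ (p, q))}"
  have fin: "finite Z" unfolding Z_def by (rule finite_noise_set)
  have q: "0 < ?q" by simp
  have "symbol_error_prob l (trap_code (r + s) l m) Z dec \<le> real (card (Z \<inter> (B1 \<union> B2))) / real (card Z)"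
    by (rule symbol_error_prob_le[OF finite_trap_code fin], unfold dec_def, rule trap_decoder_correct)
      (use a in \<open>auto simp: B1_def B2_def Z_def noise_set_def\<close>)
  also have "Z \<inter> (B1 \<union> B2) = B1 \<union> B2" unfolding B1_def B2_def by blast
  also have "real (card (B1 \<union> B2)) / real (card Z) \<le> 2 / ?q ^ s"
  proof (cases "card Z = 0")
    case False
    have "real (card B1 * CARD('a) ^ s) \<le> real (card Z)" "real (card B2 * CARD('a) ^ s) \<le> real (card Z)"
      unfolding B1_def B2_def Z_def of_nat_le_iff
      by (rule card_noise_not_top_determined[OF a(1)], rule card_noise_not_left_determined[OF a(2)])
    then have "(real (card B1) + real (card B2)) * ?q ^ s \<le> 2 * real (card Z)"
      by (simp add: distrib_right)
    moreover have "real (card (B1 \<union> B2)) \<le> real (card B1) + real (card B2)"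
      using card_Un_le[of B1 B2] by linarith
    then have "real (card (B1 \<union> B2)) * ?q ^ s \<le> (real (card B1) + real (card B2)) * ?q ^ s"
      by (rule mult_right_mono) simp
    ultimately have "real (card (B1 \<union> B2)) * ?q ^ s \<le> 2 * real (card Z)" by linarith
    then show ?thesis using False q by (simp add: field_simps)
  qed simp
  finally show ?thesis unfolding Z_def .
qed

section \<open>Rate, program length and choice of parameters\<close>

lemma code_rate_ge:
  assumes "CARD('a::{finite, field}) ^ d \<le> card (C :: 'a mat set)" "R * (real N * real l) \<le> real d"
    and "0 < N" "0 < l"
  shows "R \<le> code_rate N l C"
proof -
  have "card {0, 1 :: 'a} \<le> CARD('a)" by (rule card_mono) auto
  then have q: "1 < real CARD('a)" by simp
  have "real CARD('a) ^ d \<le> real (card C)" using assms(1) by (simp flip: of_nat_power)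
  then have "real d \<le> log (real CARD('a)) (real (card C))"
    using q by (intro le_log_of_power) auto
  with assms(2) have "R * (real N * real l) \<le> log (real CARD('a)) (real (card C))" by linarith
  then show ?thesis unfolding code_rate_def using assms(3,4) by (simp add: pos_le_divide_eq)
qed

text \<open>The capacity factors as \<open>(1 - om) * (1 - lam - lam * om)\<close>. Up to the
  constant \<open>s\<close>, the sides of the free block are \<open>\<alpha> * N\<close> and
  \<open>\<beta> * N\<close>, so its area divided by \<open>N^2\<close> tends to \<open>lam\<close>
  times the capacity, strictly above the required \<open>lam * R\<close>.\<close>

lemma trap_code_dimension_eventually:
  fixes lam om R :: real and s :: nat
  assumes lam: "0 < lam" and om: "0 < om" "om < 1"
    and rate: "0 < R" "R < 1 - lam - om + lam * om\<^sup>2"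
  shows "\<forall>\<^sub>F N in sequentially. \<forall>l r :: nat. real l = lam * real N \<longrightarrow> real r = real l * om \<longrightarrow>
    0 < N \<and> 0 < l \<and> l \<le> N \<and> r + s \<le> l \<and> r + s \<le> N - l \<and>
    R * (real N * real l) \<le> real ((l - (r + s)) * (N - l - (r + s)))"
proof -
  define \<alpha> \<beta> where "\<alpha> = lam * (1 - om)" and "\<beta> = 1 - lam - lam * om"
  have C: "1 - lam - om + lam * om\<^sup>2 = (1 - om) * \<beta>" by (simp add: \<beta>_def algebra_simps power2_eq_square)
  \<comment> \<open>A positive \<open>R\<close> forces a positive capacity and hence a positive
    \<open>\<beta>\<close>: the noise rank stays below the number of columns.\<close>
  have "0 < (1 - om) * \<beta>" using rate C by linarith
  then have \<beta>: "0 < \<beta>" using om by (simp add: zero_less_mult_iff)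
  have \<alpha>: "0 < \<alpha>" using lam om by (simp add: \<alpha>_def)
  have lim: "(\<lambda>N. real s / real N) \<longlonglongrightarrow> 0" by (rule lim_const_over_n)
  have "lam * R < lam * ((1 - om) * \<beta>)" using rate lam C by simp
  then have prod: "lam * R < (\<alpha> - 0) * (\<beta> - 0)" by (simp add: \<alpha>_def mult_ac)
  have "(\<lambda>N. (\<alpha> - real s / real N) * (\<beta> - real s / real N)) \<longlonglongrightarrow> (\<alpha> - 0) * (\<beta> - 0)"
    by (intro tendsto_intros lim)
  \<comment> \<open>The three limits yield, in this order, the rate, \<open>r + s < l\<close> and
    \<open>r + s < N - l\<close>.\<close>
  from order_tendstoD(1)[OF this prod] order_tendstoD(2)[OF lim \<alpha>] order_tendstoD(2)[OF lim \<beta>]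
    eventually_gt_at_top[of 0]
  show ?thesis
  proof eventually_elim
    case (elim N)
    show ?case
    proof (intro allI impI)
      fix l r :: nat assume l: "real l = lam * real N" and r: "real r = real l * om"
      have N: "0 < real N" using elim by simp
      have la: "real l - real (r + s) = (\<alpha> - real s / real N) * real N"
        using N l r by (simp add: \<alpha>_def algebra_simps)
      have ma: "real N - real l - real (r + s) = (\<beta> - real s / real N) * real N"
        using N l r by (simp add: \<beta>_def algebra_simps)
      have "0 < real l - real (r + s)" unfolding la using elim N by simp
      then have rl: "r + s \<le> l" by linarith
      have "0 < real N - real l - real (r + s)" unfolding ma using elim N by simp
      then have rm: "r + s \<le> N - l" and lN: "l \<le> N" by linarith+
      have "R * (real N * real l) = lam * R * (real N * real N)" using l by simp
      also have "\<dots> \<le> (\<alpha> - real s / real N) * (\<beta> - real s / real N) * (real N * real N)"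
        using elim by (intro mult_right_mono) auto
      also have "\<dots> = (real l - real (r + s)) * (real N - real l - real (r + s))"
        unfolding la ma by (simp only: mult_ac)
      also have "\<dots> = real ((l - (r + s)) * (N - l - (r + s)))"
        using rl rm lN by (simp only: of_nat_mult of_nat_diff)
      finally have "R * (real N * real l) \<le> real ((l - (r + s)) * (N - l - (r + s)))" .
      moreover have "0 < real l" using l lam N by simp
      ultimately show "0 < N \<and> 0 < l \<and> l \<le> N \<and> r + s \<le> l \<and> r + s \<le> N - l \<and>
          R * (real N * real l) \<le> real ((l - (r + s)) * (N - l - (r + s)))"
        using rl rm N lN by simp
    qed
  qed
qed

text \<open>Each of the \<open>a * a\<close> pivots costs at most \<open>3 * (l * m)\<close>
  operations, and \<open>a\<close>, \<open>l\<close>, \<open>m\<close> are at most \<open>N\<close>;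
  for \<open>l = 0\<close> there are no pivots.\<close>

lemma length_elim_slp_le:
  assumes "a \<le> l" "a \<le> m" "l + m \<le> N"
  shows "length (elim_slp l m b (pivots a)) \<le> 3 * N ^ 4"
proof (cases "l = 0")
  case True
  then show ?thesis using assms by (simp add: length_elim_slp length_pivots)
next
  case False
  then have "m \<le> l * m" by simp
  then have "2 * (l * m) + m \<le> 3 * (l * m)" by linarith
  then have "a * a * (2 * (l * m) + m) \<le> a * a * (3 * (l * m))" by (rule mult_left_mono) simp
  also have "\<dots> \<le> N * N * (3 * (N * N))" using assms by (intro mult_mono) auto
  finally show ?thesis by (simp add: length_elim_slp length_pivots power4_eq_xxxx)
qed

text \<open>The constant lands in cell \<open>l * m\<close>, right after the input, and every output
  position points to it.\<close>

lemma constant_zero_decoder: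
  fixes y :: "'a::field mat"
  assumes "y \<in> carrier_mat l m"
  shows "slp_decode l m [IConst 0] (replicate (l * m) (l * m)) y = 0\<^sub>m l m"
proof -
  have "length (mat_to_list y) = l * m"
    using assms by (simp add: mat_to_list_alt length_concat o_def sum_list_triv)
  then show ?thesis
    unfolding slp_decode_def Let_def
    by (intro eq_matI) (simp_all add: run_slp_def nth_append index_less)
qed

theorem theorem1:
  fixes lam om R :: real
  assumes hlam: "0 < lam" "lam < 1"
    and hom: "0 < om" "om < 1"
    and mult: "\<exists>k::nat. (1 - lam) / lam = real k * om"
    and rate: "R < 1 - lam - om + lam * om\<^sup>2"
  shows "\<exists>c::real. \<forall>pe::real. pe > 0 \<longrightarrow>
           (\<exists>N0::nat. \<forall>N l r :: nat. N \<ge> N0 \<longrightarrow> real l = lam * real N \<longrightarrow> real r = real l * om \<longrightarrow>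
              (\<exists>(C :: ('a::{finite, field}) mat set) (prog :: 'a instr list) (outs :: nat list).
                  C \<subseteq> carrier_mat l (N - l) \<and> C \<noteq> {} \<and>
                  code_rate N l C \<ge> R \<and>
                  wf_slp (l * (N - l)) prog outs \<and> length outs = l * (N - l) \<and>
                  symbol_error_prob l C (noise_set l (N - l) r) (slp_decode l (N - l) prog outs) < pe \<and>
                  real (length prog) \<le> c * real N ^ 4 * max 1 (ln (ln (1 / pe)))))"
proof (intro exI[of _ "3 :: real"] allI impI)
  fix pe :: real assume pe: "0 < pe"
  \<comment> \<open>The factor depending on \<open>pe\<close> is at least 1, so a program length of
    at most \<open>3 * N ^ 4\<close> suffices for every \<open>pe\<close>.\<close>
  have budget: "real k \<le> 3 * real N ^ 4 * max 1 (ln (ln (1 / pe)))" if "k \<le> 3 * N ^ 4" for k N :: nat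
  proof -
    have "real k \<le> 3 * real N ^ 4 * 1" using that by (simp flip: of_nat_power of_nat_mult)
    also have "\<dots> \<le> 3 * real N ^ 4 * max 1 (ln (ln (1 / pe)))" by (intro mult_left_mono) auto
    finally show ?thesis .
  qed
  show "\<exists>N0::nat. \<forall>N l r :: nat. N \<ge> N0 \<longrightarrow> real l = lam * real N \<longrightarrow> real r = real l * om \<longrightarrow>
      (\<exists>(C :: 'a mat set) (prog :: 'a instr list) (outs :: nat list).
          C \<subseteq> carrier_mat l (N - l) \<and> C \<noteq> {} \<and> code_rate N l C \<ge> R \<and>
          wf_slp (l * (N - l)) prog outs \<and> length outs = l * (N - l) \<and>
          symbol_error_prob l C (noise_set l (N - l) r) (slp_decode l (N - l) prog outs) < pe \<and>
          real (length prog) \<le> 3 * real N ^ 4 * max 1 (ln (ln (1 / pe))))"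
  \<comment> \<open>The dimension estimate asks for a positive \<open>R\<close>; otherwise rate 0 is
    enough and a single codeword does.\<close>
  proof (cases "R \<le> 0")
    case True
    show ?thesis
    proof (intro exI[of _ "1 :: nat"] allI impI)
      fix N l r :: nat assume N: "1 \<le> N"
      let ?C = "{0\<^sub>m l (N - l)} :: 'a mat set"
      let ?prog = "[IConst 0] :: 'a instr list" and ?outs = "replicate (l * (N - l)) (l * (N - l))"
      let ?Z = "noise_set l (N - l) r :: 'a mat set"
      have "symbol_error_prob l ?C ?Z (slp_decode l (N - l) ?prog ?outs) \<le> real (card (?Z \<inter> {})) / real (card ?Z)"
        by (rule symbol_error_prob_le[OF _ finite_noise_set])
          (auto simp: constant_zero_decoder noise_set_def)
      then have "symbol_error_prob l ?C ?Z (slp_decode l (N - l) ?prog ?outs) < pe" using pe by simp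
      moreover have "real (length ?prog) \<le> 3 * real N ^ 4 * max 1 (ln (ln (1 / pe)))"
        using N by (intro budget) simp
      ultimately show "\<exists>(C :: 'a mat set) (prog :: 'a instr list) (outs :: nat list).
          C \<subseteq> carrier_mat l (N - l) \<and> C \<noteq> {} \<and> code_rate N l C \<ge> R \<and>
          wf_slp (l * (N - l)) prog outs \<and> length outs = l * (N - l) \<and>
          symbol_error_prob l C (noise_set l (N - l) r) (slp_decode l (N - l) prog outs) < pe \<and>
          real (length prog) \<le> 3 * real N ^ 4 * max 1 (ln (ln (1 / pe)))"
        using True
        by (intro exI[of _ ?C] exI[of _ ?prog] exI[of _ ?outs]) (auto simp: code_rate_def wf_slp_iff)
    qed
  next
    case False
    have "card {0, 1 :: 'a} \<le> CARD('a)" by (rule card_mono) auto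
    then have q: "1 < real CARD('a)" by simp
    \<comment> \<open>The error bound does not involve \<open>N\<close>, so \<open>s\<close> is
      chosen from \<open>pe\<close> and the field size alone and stays fixed while \<open>N\<close>
      grows.\<close>
    have "(\<lambda>s. 2 / real CARD('a) ^ s) \<longlonglongrightarrow> 0" by (rule LIMSEQ_divide_realpow_zero[OF q])
    from order_tendstoD(2)[OF this pe] obtain s where s: "2 / real CARD('a) ^ s < pe"
      by (auto simp: eventually_sequentially)
    obtain N0 where N0: "\<And>N l r :: nat. N0 \<le> N \<Longrightarrow> real l = lam * real N \<Longrightarrow> real r = real l * om \<Longrightarrow>
        0 < N \<and> 0 < l \<and> l \<le> N \<and> r + s \<le> l \<and> r + s \<le> N - l \<and>
        R * (real N * real l) \<le> real ((l - (r + s)) * (N - l - (r + s)))"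
      using trap_code_dimension_eventually[OF hlam(1) hom _ rate, of s] False
      unfolding eventually_sequentially by (meson not_le)
    show ?thesis
    proof (intro exI[of _ N0] allI impI)
      fix N l r :: nat assume "N0 \<le> N" "real l = lam * real N" "real r = real l * om"
      note params = N0[OF this]
      define a where "a = r + s"
      let ?C = "trap_code a l (N - l) :: 'a mat set"
      let ?prog = "elim_slp l (N - l) 0 (pivots a) :: 'a instr list"
      let ?outs = "elim_outs l (N - l) (a * a)"
      have a: "a \<le> l" "a \<le> N - l" using params by (auto simp: a_def)
      have "set (pivots a) \<subseteq> {..<l} \<times> {..<N - l}" using a by (auto simp: set_pivots)
      from wf_elim_decoder[OF this] have "wf_slp (l * (N - l)) ?prog ?outs" by (simp add: length_pivots)
      moreover have "length ?outs = l * (N - l)" by (simp add: elim_outs_def)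
      moreover have "?C \<subseteq> carrier_mat l (N - l)" by (auto simp: trap_code_def)
      moreover have "?C \<noteq> {}" using zero_in_trap_code[of l "N - l" a] by blast
      moreover have "R \<le> code_rate N l ?C"
        unfolding a_def by (rule code_rate_ge[OF card_trap_code_ge]) (use params in blast)+
      moreover have "symbol_error_prob l ?C (noise_set l (N - l) r) (slp_decode l (N - l) ?prog ?outs) < pe"
        using trap_code_error_le[of r s l "N - l", where 'a = 'a] params s unfolding a_def by linarith
      moreover have "real (length ?prog) \<le> 3 * real N ^ 4 * max 1 (ln (ln (1 / pe)))"
        by (rule budget, rule length_elim_slp_le) (use a params in auto)
      ultimately show "\<exists>(C :: 'a mat set) (prog :: 'a instr list) (outs :: nat list).
          C \<subseteq> carrier_mat l (N - l) \<and> C \<noteq> {} \<and> code_rate N l C \<ge> R \<and>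
          wf_slp (l * (N - l)) prog outs \<and> length outs = l * (N - l) \<and>
          symbol_error_prob l C (noise_set l (N - l) r) (slp_decode l (N - l) prog outs) < pe \<and>
          real (length prog) \<le> 3 * real N ^ 4 * max 1 (ln (ln (1 / pe)))"
        by blast
    qed
  qed
qed

end
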